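(* Let $A\in\mathfrak{P}^{(k,\ell)}$ with $\ell$ even and $n+k-\ell\neq0$, and let $A=A_0+DA\wedge e^{(k,\ell)}$ with $DA_0=0$. (1) Suppose $k\neq\ell$. Then $[A,A]=0$ if and only if $$[A_0,A_0]=\frac{2(\ell-k)}{n+k-\ell}\,DA\wedge A_0 .$$ (2) For $k=\ell$ we have $[A,A]=0$ if and only if $$[A_0,A_0]=[DA,A_0]=0 .$$
   Context: Let $V=\mathbb{R}^n$ with linear coordinates $x^1,\dots,x^n$ and $\partial_i=\partial/\partial x^i$. $\mathfrak{P}^{(k,\ell)}\cong S^k(V^* )\otimes\Lambda^\ell V$ denotes the space of $\ell$-vector fields on $V$ whose coefficients are homogeneous polynomials of degree $k$ (zero if $k<0$, $\ell<0$ or $\ell>n$). The trace operator $D:\mathfrak{P}^{(k,\ell)}\to\mathfrak{P}^{(k-1,\ell-1)}$ is given, for $U=\frac1{\ell!}U^{j_1\ldots j_\ell}\partial_{j_1}\wedge\cdots\wedge\partial_{j_\ell}$, by $D(U)=\frac{1}{(\ell-1)!}\partial_mU^{j_1\ldots j_{\ell-1}m}\partial_{j_1}\wedge\cdots\wedge\partial_{j_{\ell-1}}$ (and $D=0$ on functions). $[\cdot,\cdot]$ is the Schouten bracket: the bilinear extension of the Lie bracket to poly-vector fields with $[X,U]=L_XU$ for vector fields $X$, $[f,g]=0$ for functions, $[U,W]=-(-1)^{(u-1)(w-1)}[W,U]$ and $[U,W\wedge Z]=[U,W]\wedge Z+(-1)^{(u-1)w}W\wedge[U,Z]$ for $U,W$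 of degrees $u,w$. Set $e^{(k,\ell)}=\frac{1}{n+k-\ell}e_0$ with $e_0=x^m\partial_m$ (sum over $m$). Every $A\in\mathfrak{P}^{(k,\ell)}$ with $n+k-\ell\neq0$ is uniquely $A=A_0+DA\wedge e^{(k,\ell)}$ with $A_0\in\mathfrak{P}^{(k,\ell)}$ trace free ($DA_0=0$). *)

theory Defs
  imports "HOL-Analysis.Analysis"
begin

text \<open>
  \<open>V = real^'n\<close>. The exterior algebra of \<open>V\<close> is \<open>real^('n set)\<close>: the coordinate \<open>I\<close> of an element
  is its coefficient at \<open>\<partial>\<^sub>i\<^sub>1 \<wedge> \<dots> \<wedge> \<partial>\<^sub>i\<^sub>l\<close>, where \<open>I = {i\<^sub>1 < \<dots> < i\<^sub>l}\<close>.
  The linear order on \<open>'n\<close> only serves to orient this basis. For disjoint \<open>I\<close>, \<open>J\<close>, the sign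
  \<open>ext_sign I J\<close> is that of the permutation sorting the concatenation of \<open>I\<close> and \<open>J\<close>.
\<close>

type_synonym 'n ext = "real^('n set)"
type_synonym 'n field = "real^'n \<Rightarrow> real^('n set)"

definition ext_sign :: "'n::linorder set \<Rightarrow> 'n set \<Rightarrow> real" where
  "ext_sign I J = (\<Prod>i\<in>I. \<Prod>j\<in>J. if j < i then -1 else 1)"

definition wedge :: "('n::{finite,linorder}) ext \<Rightarrow> 'n ext \<Rightarrow> 'n ext" (infixl "\<and>\<^sub>e" 70) where
  "a \<and>\<^sub>e b = (\<chi> K. \<Sum>I\<in>Pow K. ext_sign I (K - I) * a $ I * b $ (K - I))"

text \<open>
  If \<open>u\<close> has the skew-symmetric components \<open>u\<^bsup>j\<^sub>1\<dots>j\<^sub>l\<^esup>\<close>, i.e. \<open>u\<close> is \<open>1/l!\<close> times the sum of the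
  \<open>u\<^bsup>j\<^sub>1\<dots>j\<^sub>l\<^esup> \<partial>\<^sub>j\<^sub>1 \<wedge> \<dots> \<wedge> \<partial>\<^sub>j\<^sub>l\<close>, then \<open>lcontr m u\<close> has the components \<open>u\<^bsup>m j\<^sub>2\<dots>j\<^sub>l\<^esup>\<close>, and \<open>rcontr m u\<close>
  has the components \<open>u\<^bsup>j\<^sub>1\<dots>j\<^sub>l\<^sub>-\<^sub>1 m\<^esup>\<close>.
\<close>

definition lcontr :: "'n::{finite,linorder} \<Rightarrow> 'n ext \<Rightarrow> 'n ext" where
  "lcontr m u = (\<chi> J. if m \<in> J then 0 else ext_sign {m} J * u $ insert m J)"

definition rcontr :: "'n::{finite,linorder} \<Rightarrow> 'n ext \<Rightarrow> 'n ext" where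
  "rcontr m u = (\<chi> J. if m \<in> J then 0 else ext_sign J {m} * u $ insert m J)"

definition pd :: "'n::finite \<Rightarrow> 'n field \<Rightarrow> 'n field" where
  "pd m U x = frechet_derivative U (at x) (axis m 1)"

definition trace_op :: "('n::{finite,linorder}) field \<Rightarrow> 'n field" where
  "trace_op U x = (\<Sum>m\<in>UNIV. rcontr m (pd m U x))"

definition hom_poly :: "nat \<Rightarrow> (real^'n \<Rightarrow> real) \<Rightarrow> bool" where
  "hom_poly k f \<longleftrightarrow> (\<exists>c :: ('n \<Rightarrow> nat) \<Rightarrow> real. \<forall>x.
     f x = (\<Sum>\<alpha>\<in>{\<alpha>. (\<Sum>i\<in>UNIV. \<alpha> i) = k}. c \<alpha> * (\<Prod>i\<in>UNIV. (x $ i) ^ \<alpha> i)))"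

definition hom_field :: "int \<Rightarrow> int \<Rightarrow> ('n::finite) field set" where
  "hom_field k l = {U. \<forall>I. if 0 \<le> k \<and> int (card I) = l then hom_poly (nat k) (\<lambda>x. U x $ I)
                          else (\<forall>x. U x $ I = 0)}"

text \<open>\<open>l\<close>-vector fields with polynomial coefficients that need not be homogeneous\<close>

definition poly_field :: "int \<Rightarrow> ('n::finite) field set" where
  "poly_field l = {U. polynomial_function U \<and> (\<forall>x I. int (card I) \<noteq> l \<longrightarrow> U x $ I = 0)}"

text \<open>
  The Lie derivative in coordinates:
  \<open>(L\<^sub>X U)\<^bsup>j\<^sub>1\<dots>j\<^sub>l\<^esup> = X\<^bsup>m\<^esup> \<partial>\<^sub>m U\<^bsup>j\<^sub>1\<dots>j\<^sub>l\<^esup> - \<Sum>\<^sub>s \<partial>\<^sub>m X\<^bsup>j\<^sub>s\<^esup> U\<^bsup>j\<^sub>1\<dots>m\<dots>j\<^sub>l\<^esup>\<close>, with \<open>m\<close> at position \<open>s\<close> in the last term.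
\<close>

definition lie_deriv :: "('n::{finite,linorder}) field \<Rightarrow> 'n field \<Rightarrow> 'n field" where
  "lie_deriv X U x = (\<Sum>m\<in>UNIV. X x $ {m} *\<^sub>R pd m U x - pd m X x \<and>\<^sub>e lcontr m (U x))"

text \<open>
  The defining properties of the Schouten bracket, required on polynomial fields only. An operation
  with these properties exists: \<open>schouten_bracket_exists\<close> below.
\<close>

definition schouten_bracket ::
    "(('n::{finite,linorder}) field \<Rightarrow> 'n field \<Rightarrow> 'n field) \<Rightarrow> bool" where
  "schouten_bracket B \<longleftrightarrow>
     (\<forall>U U' W a. polynomial_function U \<longrightarrow> polynomial_function U' \<longrightarrow> polynomial_function W \<longrightarrow>
        B (\<lambda>x. a *\<^sub>R U x + U' x) W = (\<lambda>x. a *\<^sub>R B U W x + B U' W x) \<and>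
        B W (\<lambda>x. a *\<^sub>R U x + U' x) = (\<lambda>x. a *\<^sub>R B W U x + B W U' x)) \<and>
     (\<forall>X\<in>poly_field 1. \<forall>u. \<forall>U\<in>poly_field u. B X U = lie_deriv X U) \<and>
     (\<forall>f\<in>poly_field 0. \<forall>g\<in>poly_field 0. B f g = (\<lambda>x. 0)) \<and>
     (\<forall>u w. \<forall>U\<in>poly_field u. \<forall>W\<in>poly_field w.
        B U W = (\<lambda>x. - ((-1) powi ((u - 1) * (w - 1)) *\<^sub>R B W U x))) \<and>
     (\<forall>u w z. \<forall>U\<in>poly_field u. \<forall>W\<in>poly_field w. \<forall>Z\<in>poly_field z.
        B U (\<lambda>x. W x \<and>\<^sub>e Z x) =
          (\<lambda>x. B U W x \<and>\<^sub>e Z x + (-1) powi ((u - 1) * w) *\<^sub>R (W x \<and>\<^sub>e B U Z x)))"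

definition euler_field :: "('n::finite) field" where
  "euler_field x = (\<Sum>m\<in>UNIV. x $ m *\<^sub>R axis {m} 1)"

definition e_field :: "int \<Rightarrow> int \<Rightarrow> ('n::finite) field" where
  "e_field k l x = (1 / real_of_int (int CARD('n) + k - l)) *\<^sub>R euler_field x"

text \<open>The sum in \<open>hom_poly\<close> is finite.\<close>

lemma finite_exponents: "finite {\<alpha> :: 'n::finite \<Rightarrow> nat. (\<Sum>i\<in>UNIV. \<alpha> i) = k}"
proof (rule finite_subset)
  show "{\<alpha> :: 'n \<Rightarrow> nat. (\<Sum>i\<in>UNIV. \<alpha> i) = k} \<subseteq> PiE UNIV (\<lambda>_. {..k})"
    by (auto simp: PiE_def intro!: member_le_sum)
  show "finite (PiE UNIV (\<lambda>_::'n. {..k}))"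
    by (intro finite_PiE) auto
qed

lemma hom_poly_polynomial:
  fixes f :: "real^'n::finite \<Rightarrow> real"
  assumes "hom_poly k f"
  shows "polynomial_function f"
proof -
  obtain c :: "('n \<Rightarrow> nat) \<Rightarrow> real" where c: "\<forall>x. f x = (\<Sum>\<alpha>\<in>{\<alpha>. (\<Sum>i\<in>UNIV. \<alpha> i) = k}. c \<alpha> * (\<Prod>i\<in>UNIV. (x $ i) ^ \<alpha> i))"
    using assms by (auto simp: hom_poly_def)
  have f: "f = (\<lambda>x. \<Sum>\<alpha>\<in>{\<alpha>. (\<Sum>i\<in>UNIV. \<alpha> i) = k}. c \<alpha> * (\<Prod>i\<in>UNIV. (x $ i) ^ \<alpha> i))"
    using c by auto
  have "real_polynomial_function f"
    unfolding f
    by (intro real_polynomial_function_sum finite_exponents real_polynomial_function.intros(2,4)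
        real_polynomial_function_prod real_polynomial_function_power finite_UNIV
        real_polynomial_function.intros(1) bounded_linear_vec_nth)
      auto
  thus ?thesis by (simp add: real_polynomial_function_eq)
qed

lemma polynomial_function_vec_nth:
  "polynomial_function (U :: 'a::real_normed_vector \<Rightarrow> real^'m::finite) \<longleftrightarrow> (\<forall>I. polynomial_function (\<lambda>x. U x $ I))"
  by (auto simp: polynomial_function_iff_Basis_inner[where 'b="real^'m"] Basis_vec_def inner_axis
      real_polynomial_function_eq)

lemma hom_field_subset_poly_field: "hom_field k l \<subseteq> poly_field l"
proof
  fix U :: "'a::finite field"
  assume U: "U \<in> hom_field k l"
  have "polynomial_function (\<lambda>x. U x $ I)" for I
    using U hom_poly_polynomial[of "nat k" "\<lambda>x. U x $ I"]
    by (auto simp: hom_field_def split: if_splits dest!: spec[of _ I])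
  thus "U \<in> poly_field l"
    using U by (auto simp: poly_field_def hom_field_def polynomial_function_vec_nth)
qed

lemma ext_sign_Un1: "I \<inter> I' = {} \<Longrightarrow> ext_sign ((I::'n::{finite,linorder} set) \<union> I') J = ext_sign I J * ext_sign I' J"
  unfolding ext_sign_def by (rule prod.union_disjoint) auto

lemma ext_sign_Un2: "J \<inter> J' = {} \<Longrightarrow> ext_sign I ((J::'n::{finite,linorder} set) \<union> J') = ext_sign I J * ext_sign I J'"
  unfolding ext_sign_def
  by (simp add: prod.union_disjoint prod.distrib)

lemma ext_sign_square: "ext_sign (I::'n::{finite,linorder} set) J * ext_sign I J = 1"
  unfolding ext_sign_def prod.distrib[symmetric] by (auto intro!: prod.neutral)

lemma ext_sign_commute:
  assumes "I \<inter> J = {}"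
  shows "ext_sign (I::'n::{finite,linorder} set) J = (-1) ^ (card I * card J) * ext_sign J I"
proof -
  have "ext_sign I J * ext_sign J I = (\<Prod>i\<in>I. \<Prod>j\<in>J. (if j < i then -1 else 1) * (if i < j then -1 else (1::real)))"
    unfolding ext_sign_def prod.distrib by (subst (2) prod.swap) simp
  also have "\<dots> = (\<Prod>i\<in>I. \<Prod>j\<in>J. -1)"
    using assms by (intro prod.cong refl) (auto simp: not_less_iff_gr_or_eq)
  also have "\<dots> = (-1) ^ (card I * card J)"
    by (simp add: mult.commute flip: power_mult) 
  finally have "ext_sign I J * (ext_sign J I * ext_sign J I) = (-1) ^ (card I * card J) * ext_sign J I"
    by (simp add: mult.assoc)
  thus ?thesis by (simp add: ext_sign_square)
qed

lemma wedge_nth: "(a \<and>\<^sub>e b) $ K = (\<Sum>I\<in>Pow K. ext_sign I (K - I) * a $ I * b $ (K - I))"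
  by (simp add: wedge_def)

lemma bilinear_wedge: "bilinear (\<and>\<^sub>e)"
  by (auto simp: bilinear_def linear_iff vec_eq_iff wedge_nth algebra_simps sum.distrib sum_distrib_left)

lemma bounded_bilinear_wedge: "bounded_bilinear (\<and>\<^sub>e)"
  using bilinear_wedge by (simp add: bilinear_conv_bounded_bilinear)

interpretation wedge: bounded_bilinear "(\<and>\<^sub>e) :: ('n::{finite,linorder}) ext \<Rightarrow> _"
  by (rule bounded_bilinear_wedge)

lemma wedge_assoc: "(a \<and>\<^sub>e b) \<and>\<^sub>e c = a \<and>\<^sub>e (b \<and>\<^sub>e c)"
proof (rule vec_eq_iff[THEN iffD2], rule allI)
  fix K :: "'a set"
  have "((a \<and>\<^sub>e b) \<and>\<^sub>e c) $ K = (\<Sum>L\<in>Pow K. \<Sum>I\<in>Pow L.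
      ext_sign L (K - L) * ext_sign I (L - I) * a $ I * b $ (L - I) * c $ (K - L))"
    by (simp add: wedge_nth sum_distrib_left sum_distrib_right mult_ac)
  also have "\<dots> = (\<Sum>(L, I)\<in>(SIGMA L:Pow K. Pow L).
      ext_sign L (K - L) * ext_sign I (L - I) * a $ I * b $ (L - I) * c $ (K - L))"
    by (rule sum.Sigma) auto
  also have "\<dots> = (\<Sum>(I, J)\<in>(SIGMA I:Pow K. Pow (K - I)).
      ext_sign I (K - I) * ext_sign J (K - I - J) * a $ I * b $ J * c $ (K - I - J))"
  proof (rule sum.reindex_bij_witness[where i = "\<lambda>(I, J). (I \<union> J, I)" and j = "\<lambda>(L, I). (I, L - I)"], goal_cases)
    case (5 p)
    obtain L I where p: "p = (L, I)" by force
    hence LI: "L \<subseteq> K" "I \<subseteq> L" using 5 by auto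
    have 1: "L = I \<union> (L - I)" "K - I = (L - I) \<union> (K - L)" "K - I - (L - I) = K - L" using LI by auto
    have "ext_sign L (K - L) = ext_sign I (K - L) * ext_sign (L - I) (K - L)"
      by (subst 1(1), rule ext_sign_Un1) auto
    moreover have "ext_sign I (K - I) = ext_sign I (L - I) * ext_sign I (K - L)"
      by (subst 1(2), rule ext_sign_Un2) auto
    ultimately show ?case by (simp add: p 1(3))
  qed auto
  also have "\<dots> = (\<Sum>I\<in>Pow K. \<Sum>J\<in>Pow (K - I).
      ext_sign I (K - I) * ext_sign J (K - I - J) * a $ I * b $ J * c $ (K - I - J))"
    by (rule sum.Sigma[symmetric]) auto
  also have "\<dots> = (a \<and>\<^sub>e (b \<and>\<^sub>e c)) $ K"
    by (simp add: wedge_nth sum_distrib_left sum_distrib_right mult_ac)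
  finally show "((a \<and>\<^sub>e b) \<and>\<^sub>e c) $ K = (a \<and>\<^sub>e (b \<and>\<^sub>e c)) $ K" .
qed

definition ext_deg :: "int \<Rightarrow> ('n::finite) ext set" where
  "ext_deg l = {a. \<forall>I. int (card I) \<noteq> l \<longrightarrow> a $ I = 0}"

lemma minus_one_powi_nat: "((-1) powi (int m)::real) = (-1) ^ m"
  by simp

lemma minus_one_powi_cong: "even (p - q) \<Longrightarrow> ((-1) powi p :: real) = (-1) powi q"
  by (auto simp: power_int_minus_left)

lemma wedge_commute:
  assumes "a \<in> ext_deg p" "b \<in> ext_deg q"
  shows "a \<and>\<^sub>e b = (-1) powi (p * q) *\<^sub>R (b \<and>\<^sub>e a)"
proof (rule vec_eq_iff[THEN iffD2], rule allI)
  fix K :: "'a set"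
  have "(a \<and>\<^sub>e b) $ K = (\<Sum>I\<in>Pow K. (-1) powi (p * q) * (ext_sign (K - I) I * b $ (K - I) * a $ I))"
    unfolding wedge_nth
  proof (rule sum.cong[OF refl], goal_cases)
    case (1 I)
    show ?case
    proof (cases "int (card I) = p \<and> int (card (K - I)) = q")
      case True
      have "ext_sign I (K - I) = (-1) ^ (card I * card (K - I)) * ext_sign (K - I) I"
        by (rule ext_sign_commute) auto
      also have "(-1) ^ (card I * card (K - I)) = ((-1) powi (p * q) :: real)"
        using True by (metis minus_one_powi_nat of_nat_mult)
      finally show ?thesis by (simp add: mult_ac)
    next
      case False
      thus ?thesis using assms by (auto simp: ext_deg_def)
    qed
  qed
  also have "\<dots> = (\<Sum>I\<in>Pow K. (-1) powi (p * q) * (ext_sign I (K - I) * b $ I * a $ (K - I)))"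
    by (rule sum.reindex_bij_witness[where i = "\<lambda>I. K - I" and j = "\<lambda>I. K - I"]) (auto simp: double_diff)
  also have "\<dots> = ((-1) powi (p * q) *\<^sub>R (b \<and>\<^sub>e a)) $ K"
    by (simp add: wedge_nth sum_distrib_left)
  finally show "(a \<and>\<^sub>e b) $ K = ((-1) powi (p * q) *\<^sub>R (b \<and>\<^sub>e a)) $ K" .
qed

lemma lcontr_wedge:
  assumes "a \<in> ext_deg p"
  shows "lcontr m (a \<and>\<^sub>e b) = lcontr m a \<and>\<^sub>e b + (-1) powi p *\<^sub>R (a \<and>\<^sub>e lcontr m b)"
proof (rule vec_eq_iff[THEN iffD2], rule allI)
  fix K :: "'a set"
  show "lcontr m (a \<and>\<^sub>e b) $ K = (lcontr m a \<and>\<^sub>e b + (-1) powi p *\<^sub>R (a \<and>\<^sub>e lcontr m b)) $ K"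
  proof (cases "m \<in> K")
    case True
    have *: "(lcontr m a \<and>\<^sub>e b) $ K = (\<Sum>I\<in>Pow (K - {m}). ext_sign {m} I * ext_sign I (K - I) * a $ insert m I * b $ (K - I))"
      unfolding wedge_nth
      by (rule sum.mono_neutral_cong_right) (auto simp: lcontr_def)
    have **: "(a \<and>\<^sub>e lcontr m b) $ K = (\<Sum>I\<in>insert m ` Pow (K - {m}). ext_sign I (K - I) * ext_sign {m} (K - I) * a $ I * b $ insert m (K - I))"
      unfolding wedge_nth
    proof (rule sum.mono_neutral_cong_right)
      show "\<forall>i\<in>Pow K - insert m ` Pow (K - {m}). ext_sign i (K - i) * a $ i * lcontr m b $ (K - i) = 0"
      proof
        fix i assume i: "i \<in> Pow K - insert m ` Pow (K - {m})"
        have "m \<notin> i"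
        proof
          assume "m \<in> i"
          hence "i = insert m (i - {m})" "i - {m} \<in> Pow (K - {m})" using i by auto
          thus False using i by blast
        qed
        thus "ext_sign i (K - i) * a $ i * lcontr m b $ (K - i) = 0" using True by (simp add: lcontr_def)
      qed
    qed (use True in \<open>auto simp: lcontr_def\<close>)
    also have "\<dots> = (\<Sum>I\<in>Pow (K - {m}). ext_sign (insert m I) (K - insert m I) * ext_sign {m} (K - insert m I) * a $ insert m I * b $ insert m (K - insert m I))"
      by (subst sum.reindex) (auto simp: inj_on_def)
    finally have ***: "(a \<and>\<^sub>e lcontr m b) $ K = \<dots>" .
    have "(-1) powi p * (a \<and>\<^sub>e lcontr m b) $ K = - (\<Sum>I\<in>Pow (K - {m}). ext_sign {m} I * ext_sign I (K - I) * a $ insert m I * b $ (K - I))"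
      unfolding *** sum_distrib_left sum_negf[symmetric]
    proof (rule sum.cong[OF refl], goal_cases)
      case (1 I)
      let ?J = "K - insert m I"
      have e: "insert m ?J = K - I" "insert m I = {m} \<union> I" "K - I = {m} \<union> ?J" using 1 True by auto
      have s1: "ext_sign (insert m I) ?J = ext_sign {m} ?J * ext_sign I ?J"
        by (subst e(2), rule ext_sign_Un1) (use 1 in auto)
      have s2: "ext_sign I (K - I) = ext_sign I {m} * ext_sign I ?J"
        by (subst e(3), rule ext_sign_Un2) (use 1 in auto)
      have s3: "ext_sign I {m} = (-1) ^ card I * ext_sign {m} I"
        using ext_sign_commute[of I "{m}"] 1 by auto
      show ?case
      proof (cases "int (card (insert m I)) = p")
        case T: True
        have "m \<notin> I" using 1 by auto
        hence "p = int (Suc (card I))" using T by (simp add: finite)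
        hence pw: "((-1) powi p :: real) = - ((-1) ^ card I)"
          by (simp only: minus_one_powi_nat) simp
        have gen: "- e * (x * q * x * a * b) = - (y * (e * y * q) * a * b)"
          if "x * x = 1" "y * y = 1" for a b e q x y :: real
        proof -
          have "- e * (x * q * x * a * b) = - ((x * x) * (e * q * a * b))" by (simp add: mult_ac)
          also have "\<dots> = - ((y * y) * (e * q * a * b))" using that by simp
          finally show ?thesis by (simp add: mult_ac)
        qed
        have "ext_sign {m} ?J * ext_sign {m} ?J = 1" by (rule ext_sign_square)
        moreover have "ext_sign {m} I * ext_sign {m} I = 1" by (rule ext_sign_square)
        ultimately show ?thesis unfolding s1 pw e(1) unfolding s2 s3 by (rule gen)
      next
        case False
        thus ?thesis using assms by (auto simp: ext_deg_def)
      qed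
    qed
    hence "(lcontr m a \<and>\<^sub>e b + (-1) powi p *\<^sub>R (a \<and>\<^sub>e lcontr m b)) $ K = 0"
      by (simp add: *)
    thus ?thesis using True by (simp add: lcontr_def)
  next
    case False
    have sub: "Pow (insert m K) = Pow K \<union> insert m ` Pow K" by (rule Pow_insert)
    have disj: "Pow K \<inter> insert m ` Pow K = {}" using False by auto
    have "lcontr m (a \<and>\<^sub>e b) $ K = ext_sign {m} K * (\<Sum>I\<in>Pow (insert m K). ext_sign I (insert m K - I) * a $ I * b $ (insert m K - I))"
      using False by (simp add: lcontr_def wedge_nth)
    also have "\<dots> = (\<Sum>I\<in>Pow K. ext_sign {m} K * ext_sign I (insert m K - I) * a $ I * b $ (insert m K - I))
        + (\<Sum>I\<in>insert m ` Pow K. ext_sign {m} K * ext_sign I (insert m K - I) * a $ I * b $ (insert m K - I))"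
      unfolding sub by (subst sum.union_disjoint) (use disj in \<open>auto simp: sum_distrib_left algebra_simps\<close>)
    also have "(\<Sum>I\<in>insert m ` Pow K. ext_sign {m} K * ext_sign I (insert m K - I) * a $ I * b $ (insert m K - I))
       = (\<Sum>I\<in>Pow K. ext_sign {m} K * ext_sign (insert m I) (insert m K - insert m I) * a $ insert m I * b $ (insert m K - insert m I))"
      by (subst sum.reindex) (use False in \<open>auto simp: inj_on_def\<close>)
    also have "\<dots> = (lcontr m a \<and>\<^sub>e b) $ K"
      unfolding wedge_nth
    proof (rule sum.cong[OF refl], goal_cases)
      case (1 I)
      have m: "m \<notin> I" using 1 False by auto
      have e: "insert m K - insert m I = K - I" "insert m I = {m} \<union> I" "K = I \<union> (K - I)" using 1 m False by auto
      have s1: "ext_sign (insert m I) (K - I) = ext_sign {m} (K - I) * ext_sign I (K - I)"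
        by (subst e(2), rule ext_sign_Un1) (use m in auto)
      have s2: "ext_sign {m} K = ext_sign {m} I * ext_sign {m} (K - I)"
        by (subst e(3), rule ext_sign_Un2) auto
      have "ext_sign {m} (K - I) * ext_sign {m} (K - I) = 1" by (rule ext_sign_square)
      moreover have "a * x * (x * e) * p * q = e * (a * p) * q" if "x * x = 1" for a x e p q :: real
      proof -
        have "a * x * (x * e) * p * q = (x * x) * (e * (a * p) * q)" by (simp add: mult_ac)
        thus ?thesis using that by simp
      qed
      ultimately show ?case unfolding e(1) s1 s2 using m by (simp add: lcontr_def)
    qed
    also have "(\<Sum>I\<in>Pow K. ext_sign {m} K * ext_sign I (insert m K - I) * a $ I * b $ (insert m K - I))
      = (-1) powi p * (a \<and>\<^sub>e lcontr m b) $ K"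
      unfolding wedge_nth sum_distrib_left
    proof (rule sum.cong[OF refl], goal_cases)
      case (1 I)
      have m: "m \<notin> I" using 1 False by auto
      have e: "insert m K - I = {m} \<union> (K - I)" "insert m K - I = insert m (K - I)" "K = I \<union> (K - I)" using 1 m False by auto
      have s1: "ext_sign I (insert m K - I) = ext_sign I {m} * ext_sign I (K - I)"
        by (subst e(1), rule ext_sign_Un2) (use False in auto)
      have s2: "ext_sign {m} K = ext_sign {m} I * ext_sign {m} (K - I)"
        by (subst e(3), rule ext_sign_Un2) auto
      have s3: "ext_sign I {m} = (-1) ^ card I * ext_sign {m} I"
        using ext_sign_commute[of I "{m}"] m by auto
      have sq: "ext_sign {m} I * ext_sign {m} I = 1" by (rule ext_sign_square)
      show ?case
      proof (cases "int (card I) = p")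
        case True
        hence "((-1) powi p :: real) = (-1) ^ card I" by (metis minus_one_powi_nat)
        moreover have "x * y * (e * x * z) * p * q = e * (z * p * (y * q))" if "x * x = 1" for x y z e p q :: real
        proof -
          have "x * y * (e * x * z) * p * q = (x * x) * (e * (z * p * (y * q)))" by (simp add: mult_ac)
          thus ?thesis using that by simp
        qed
        ultimately show ?thesis
          unfolding s1 e(2)[symmetric] unfolding s2 s3 using \<open>m \<notin> K\<close> sq by (simp add: lcontr_def e(2))
      next
        case False
        thus ?thesis using assms by (auto simp: ext_deg_def)
      qed
    qed
    finally show ?thesis by simp
  qed
qed

lemma rcontr_lcontr:
  assumes "u \<in> ext_deg p"
  shows "rcontr m u = (-1) powi (p - 1) *\<^sub>R lcontr m u"
proof (rule vec_eq_iff[THEN iffD2], rule allI)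
  fix J :: "'a set"
  show "rcontr m u $ J = ((-1) powi (p - 1) *\<^sub>R lcontr m u) $ J"
  proof (cases "m \<in> J \<or> int (card (insert m J)) \<noteq> p")
    case True
    thus ?thesis using assms by (auto simp: rcontr_def lcontr_def ext_deg_def)
  next
    case False
    hence "p - 1 = int (card J)" by auto
    hence "((-1) powi (p - 1) :: real) = (-1) ^ card J" by (metis minus_one_powi_nat)
    moreover have "ext_sign J {m} = (-1) ^ card J * ext_sign {m} J"
      using ext_sign_commute[of J "{m}"] False by auto
    ultimately show ?thesis using False by (simp add: rcontr_def lcontr_def)
  qed
qed

lemma linear_lcontr: "linear (lcontr m)"
  by (auto simp: linear_iff lcontr_def vec_eq_iff algebra_simps)

lemma linear_rcontr: "linear (rcontr m)"
  by (auto simp: linear_iff rcontr_def vec_eq_iff algebra_simps)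

lemma lcontr_deg: "u \<in> ext_deg p \<Longrightarrow> lcontr m u \<in> ext_deg (p - 1)"
  by (auto simp: ext_deg_def lcontr_def)

lemma rcontr_deg: "u \<in> ext_deg p \<Longrightarrow> rcontr m u \<in> ext_deg (p - 1)"
  by (auto simp: ext_deg_def rcontr_def)

lemma poly_field_iff: "U \<in> poly_field l \<longleftrightarrow> polynomial_function U \<and> (\<forall>x. U x \<in> ext_deg l)"
  by (auto simp: poly_field_def ext_deg_def)

lemma pd_has_derivative:
  fixes U :: "'n::finite field"
  shows "polynomial_function U \<Longrightarrow> (U has_derivative frechet_derivative U (at x)) (at x)"
  using differentiable_at_polynomial_function[of U x UNIV] frechet_derivative_works by blast

lemma pd_eqI: "(U has_derivative U') (at x) \<Longrightarrow> pd m U x = U' (axis m 1)"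
  unfolding pd_def by (metis frechet_derivative_at)

lemma pd_linear:
  assumes "polynomial_function U" "polynomial_function U'"
  shows "pd m (\<lambda>x. a *\<^sub>R U x + U' x) x = a *\<^sub>R pd m U x + pd m U' x"
proof -
  have "((\<lambda>x. a *\<^sub>R U x + U' x) has_derivative
     (\<lambda>h. a *\<^sub>R frechet_derivative U (at x) h + frechet_derivative U' (at x) h)) (at x)"
    using assms by (intro has_derivative_add has_derivative_scaleR_right pd_has_derivative)
  from pd_eqI[OF this] show ?thesis by (simp add: pd_def)
qed

lemma pd_wedge:
  assumes "polynomial_function U" "polynomial_function W"
  shows "pd m (\<lambda>x. U x \<and>\<^sub>e W x) x = U x \<and>\<^sub>e pd m W x + pd m U x \<and>\<^sub>e W x"
  using pd_eqI[OF wedge.FDERIV[OF assms[THEN pd_has_derivative]]] by (simp add: pd_def)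

lemma pd_deg:
  assumes "U \<in> poly_field l"
  shows "pd m U x \<in> ext_deg l"
  unfolding ext_deg_def
proof (safe)
  fix I :: "'a set" assume I: "int (card I) \<noteq> l"
  have "((\<lambda>x. U x $ I) has_derivative (\<lambda>h. frechet_derivative U (at x) h $ I)) (at x)"
    using assms by (intro bounded_linear.has_derivative[OF bounded_linear_vec_nth] pd_has_derivative)
      (auto simp: poly_field_def)
  moreover have "(\<lambda>x. U x $ I) = (\<lambda>x. 0)" using assms I by (auto simp: poly_field_def)
  ultimately have "((\<lambda>x. 0) has_derivative (\<lambda>h. frechet_derivative U (at x) h $ I)) (at x)" by simp
  hence "(\<lambda>h. frechet_derivative U (at x) h $ I) = (\<lambda>h. 0)"
    using has_derivative_const has_derivative_unique by blast
  thus "pd m U x $ I = 0" by (simp add: pd_def fun_eq_iff)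
qed

text \<open>
  The coordinate expression of the Schouten bracket, used only to show that \<open>schouten_bracket\<close>
  is satisfiable.
\<close>

definition schouten :: "('n::{finite,linorder}) field \<Rightarrow> 'n field \<Rightarrow> 'n field" where
  "schouten U W x = (\<Sum>m\<in>UNIV. rcontr m (U x) \<and>\<^sub>e pd m W x - pd m U x \<and>\<^sub>e lcontr m (W x))"

lemma rcontr_vector: 
  assumes "u \<in> ext_deg 1"
  shows "rcontr m u \<and>\<^sub>e w = u $ {m} *\<^sub>R w"
proof -
  have r: "rcontr m u $ I = (if I = {} then u $ {m} else 0)" for I
  proof (cases "I = {}")
    case True thus ?thesis by (simp add: rcontr_def ext_sign_def)
  next
    case False
    hence "card (insert m I) \<noteq> 1" if "m \<notin> I" using that by (auto simp: card_eq_0_iff)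
    thus ?thesis using assms False by (auto simp: rcontr_def ext_deg_def)
  qed
  have "(rcontr m u \<and>\<^sub>e w) $ K = (u $ {m} *\<^sub>R w) $ K" for K
  proof -
    have "(rcontr m u \<and>\<^sub>e w) $ K = (\<Sum>I\<in>{{}}. ext_sign I (K - I) * rcontr m u $ I * w $ (K - I))"
      unfolding wedge_nth by (rule sum.mono_neutral_right) (auto simp: r)
    thus ?thesis by (simp add: r ext_sign_def)
  qed
  thus ?thesis by (simp add: vec_eq_iff)
qed

lemma contr_function:
  assumes "u \<in> ext_deg 0"
  shows "rcontr m u = 0" "lcontr m u = 0"
  using assms by (auto simp: rcontr_def lcontr_def ext_deg_def vec_eq_iff card_eq_0_iff)

lemma schouten_antisym:
  assumes U: "U \<in> poly_field u" and W: "W \<in> poly_field w"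
  shows "schouten U W x = - ((-1) powi ((u - 1) * (w - 1)) *\<^sub>R schouten W U x)"
proof -
  let ?s = "(-1) powi ((u - 1) * (w - 1)) :: real"
  have deg: "U x \<in> ext_deg u" "W x \<in> ext_deg w" using U W by (auto simp: poly_field_iff)
  have "rcontr m (U x) \<and>\<^sub>e pd m W x = ?s *\<^sub>R (pd m W x \<and>\<^sub>e lcontr m (U x))" for m
  proof -
    have "rcontr m (U x) \<and>\<^sub>e pd m W x = (-1) powi (u - 1) *\<^sub>R (lcontr m (U x) \<and>\<^sub>e pd m W x)"
      by (simp add: rcontr_lcontr[OF deg(1)] wedge.scaleR_left)
    also have "\<dots> = ((-1) powi (u - 1) * (-1) powi ((u - 1) * w)) *\<^sub>R (pd m W x \<and>\<^sub>e lcontr m (U x))"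
      by (subst wedge_commute[OF lcontr_deg[OF deg(1)] pd_deg[OF W]]) simp
    also have "(-1) powi (u - 1) * (-1) powi ((u - 1) * w) = ?s"
      by (subst power_int_add[symmetric]) (auto simp: power_int_minus_left)
    finally show ?thesis .
  qed
  moreover have "pd m U x \<and>\<^sub>e lcontr m (W x) = ?s *\<^sub>R (rcontr m (W x) \<and>\<^sub>e pd m U x)" for m
  proof -
    have "rcontr m (W x) \<and>\<^sub>e pd m U x = (-1) powi (w - 1) *\<^sub>R (lcontr m (W x) \<and>\<^sub>e pd m U x)"
      by (simp add: rcontr_lcontr[OF deg(2)] wedge.scaleR_left)
    also have "\<dots> = ((-1) powi (w - 1) * (-1) powi ((w - 1) * u)) *\<^sub>R (pd m U x \<and>\<^sub>e lcontr m (W x))"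
      by (subst wedge_commute[OF lcontr_deg[OF deg(2)] pd_deg[OF U]]) simp
    finally have "?s *\<^sub>R (rcontr m (W x) \<and>\<^sub>e pd m U x)
      = (?s * ((-1) powi (w - 1) * (-1) powi ((w - 1) * u))) *\<^sub>R (pd m U x \<and>\<^sub>e lcontr m (W x))" by simp
    also have "?s * ((-1) powi (w - 1) * (-1) powi ((w - 1) * u)) = 1"
      by (subst power_int_add[symmetric], simp, subst power_int_add[symmetric]) (auto simp: power_int_minus_left)
    finally show ?thesis by simp
  qed
  ultimately show ?thesis
    by (simp add: schouten_def scaleR_sum_right scaleR_diff_right flip: sum_negf)
qed

lemma schouten_wedge:
  assumes U: "U \<in> poly_field u" and W: "W \<in> poly_field w" and Z: "Z \<in> poly_field z"
  shows "schouten U (\<lambda>x. W x \<and>\<^sub>e Z x) x =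
    schouten U W x \<and>\<^sub>e Z x + (-1) powi ((u - 1) * w) *\<^sub>R (W x \<and>\<^sub>e schouten U Z x)"
proof -
  let ?s = "(-1) powi ((u - 1) * w) :: real"
  have deg: "U x \<in> ext_deg u" "W x \<in> ext_deg w" "Z x \<in> ext_deg z"
    using U W Z by (auto simp: poly_field_iff)
  have pol: "polynomial_function W" "polynomial_function Z" using W Z by (auto simp: poly_field_iff)
  have *: "rcontr m (U x) \<and>\<^sub>e (W x \<and>\<^sub>e pd m Z x) = ?s *\<^sub>R (W x \<and>\<^sub>e (rcontr m (U x) \<and>\<^sub>e pd m Z x))" for m
    by (subst wedge_assoc[symmetric], subst wedge_commute[OF rcontr_deg[OF deg(1)] deg(2)])
      (simp add: wedge.scaleR_left wedge_assoc)
  have **: "(-1) powi w *\<^sub>R (pd m U x \<and>\<^sub>e (W x \<and>\<^sub>e lcontr m (Z x))) = ?s *\<^sub>R (W x \<and>\<^sub>e (pd m U x \<and>\<^sub>e lcontr m (Z x)))" for m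
  proof -
    have "(-1) powi w *\<^sub>R (pd m U x \<and>\<^sub>e (W x \<and>\<^sub>e lcontr m (Z x))) =
      ((-1) powi w * (-1) powi (u * w)) *\<^sub>R (W x \<and>\<^sub>e (pd m U x \<and>\<^sub>e lcontr m (Z x)))"
      by (subst wedge_assoc[symmetric], subst wedge_commute[OF pd_deg[OF U] deg(2)])
        (simp add: wedge.scaleR_left wedge_assoc)
    also have "(-1) powi w * (-1) powi (u * w) = ?s"
      by (subst power_int_add[symmetric]) (auto simp: power_int_minus_left)
    finally show ?thesis .
  qed
  have "rcontr m (U x) \<and>\<^sub>e pd m (\<lambda>x. W x \<and>\<^sub>e Z x) x - pd m U x \<and>\<^sub>e lcontr m (W x \<and>\<^sub>e Z x) =
    (rcontr m (U x) \<and>\<^sub>e pd m W x - pd m U x \<and>\<^sub>e lcontr m (W x)) \<and>\<^sub>e Z x +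
    ?s *\<^sub>R (W x \<and>\<^sub>e (rcontr m (U x) \<and>\<^sub>e pd m Z x - pd m U x \<and>\<^sub>e lcontr m (Z x)))" for m
    using *[of m] **[of m]
    by (simp add: pd_wedge[OF pol] lcontr_wedge[OF deg(2)] wedge.add_right wedge.diff_left wedge.diff_right
        wedge.scaleR_right wedge_assoc scaleR_diff_right)
  thus ?thesis
    by (simp add: schouten_def sum.distrib wedge.sum_left wedge.sum_right scaleR_sum_right)
qed

theorem schouten_bracket_exists: "schouten_bracket schouten"
  unfolding schouten_bracket_def
proof (intro conjI allI ballI impI ext)
  fix U U' W :: "'a field" and a :: real and x
  assume pol: "polynomial_function U" "polynomial_function U'" "polynomial_function W"
  note simps = schouten_def pd_linear[OF pol(1,2)] linear_add[OF linear_lcontr] linear_add[OF linear_rcontr]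
    linear_scale[OF linear_lcontr] linear_scale[OF linear_rcontr] wedge.add_left wedge.add_right
    wedge.scaleR_left wedge.scaleR_right scaleR_sum_right
  show "schouten (\<lambda>x. a *\<^sub>R U x + U' x) W x = a *\<^sub>R schouten U W x + schouten U' W x"
    by (simp add: simps flip: sum.distrib) (simp add: algebra_simps)
  show "schouten W (\<lambda>x. a *\<^sub>R U x + U' x) x = a *\<^sub>R schouten W U x + schouten W U' x"
    by (simp add: simps flip: sum.distrib) (simp add: algebra_simps)
next
  fix X U :: "'a field" and u x
  assume "X \<in> poly_field 1"
  hence "X x \<in> ext_deg 1" by (auto simp: poly_field_iff)
  thus "schouten X U x = lie_deriv X U x" by (simp add: schouten_def lie_deriv_def rcontr_vector)
next
  fix f g :: "'a field" and x
  assume "f \<in> poly_field 0" "g \<in> poly_field 0"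
  hence "f x \<in> ext_deg 0" "g x \<in> ext_deg 0" by (auto simp: poly_field_iff)
  thus "schouten f g x = 0"
    by (simp add: schouten_def contr_function wedge.zero_left wedge.zero_right)
qed (rule schouten_antisym schouten_wedge; assumption)+

end

theory Submission
  imports Defs
begin

text \<open>
  Write \<open>D\<close> for the trace operator, \<open>F = DA\<close> and \<open>e\<close> for the scaled Euler field \<open>c e\<^sub>0\<close> with
  \<open>c = 1 / (n + k - l)\<close>. Two computations carry the proof.

  First, the Euler field acts on homogeneous \<open>l\<close>-vector fields of degree \<open>k\<close> by
  \<open>[e\<^sub>0, U] = (k - l) U\<close> (\<open>schouten_scaled_euler\<close>). Since \<open>F\<close> has odd degree, \<open>[F, F] = 0\<close> and
  \<open>F \<and> F = 0\<close>, and with the Leibniz rule these give \<open>[F, F \<and> e] = 0\<close> and \<open>[F \<and> e, F \<and> e] = 0\<close>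
  (\<open>schouten_euler_wedge\<close>). Expanding \<open>A = A\<^sub>0 + F \<and> e\<close> therefore leaves
  \<open>[A, A] = [A\<^sub>0, A\<^sub>0] - 2 [F, A\<^sub>0] \<and> e - 2 c (l - k) F \<and> A\<^sub>0\<close>.
  Once \<open>[F, A\<^sub>0] = 0\<close> is known, both equivalences can be read off from this formula.

  Second, the bracket measures the failure of \<open>D\<close> to be a derivation of the wedge product
  (\<open>trace_op_wedge\<close>). As \<open>D \<circ> D = 0\<close> (\<open>trace_op_trace_op\<close>), applying \<open>D\<close> to that identity shows that \<open>D\<close> is
  a derivation of the bracket (\<open>trace_op_schouten\<close>). Hence \<open>D [A, A] = - 2 [F, A] = - 2 [F, A\<^sub>0]\<close>, so
  \<open>[A, A] = 0\<close> forces \<open>[F, A\<^sub>0] = 0\<close>. Conversely \<open>D [A\<^sub>0, A\<^sub>0] = 0\<close> and \<open>D (F \<and> A\<^sub>0) = [F, A\<^sub>0]\<close>, so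
  for \<open>k \<noteq> l\<close> the equation \<open>[A\<^sub>0, A\<^sub>0] = 2 c (l - k) F \<and> A\<^sub>0\<close> forces \<open>[F, A\<^sub>0] = 0\<close> too.

  These computations use the coordinate expression \<open>schouten\<close>. They transfer to an arbitrary Schouten bracket
  because its defining properties determine it on polynomial fields (\<open>schouten_bracket_unique\<close>).
\<close>

section \<open>Contractions and the wedge product\<close>

lemma wedge_deg:
  assumes "a \<in> ext_deg p" "b \<in> ext_deg q"
  shows "a \<and>\<^sub>e b \<in> ext_deg (p + q)"
proof -
  have "(a \<and>\<^sub>e b) $ K = 0" if K: "int (card K) \<noteq> p + q" for K
    unfolding wedge_nth
  proof (intro sum.neutral ballI)
    fix I assume "I \<in> Pow K"
    hence "card K = card I + card (K - I)"
      by (metis PowD card_Diff_subset card_mono finite le_add_diff_inverse)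
    hence "int (card I) \<noteq> p \<or> int (card (K - I)) \<noteq> q" using K by auto
    thus "ext_sign I (K - I) * a $ I * b $ (K - I) = 0"
      using assms by (auto simp: ext_deg_def)
  qed
  thus ?thesis by (auto simp: ext_deg_def)
qed

lemma wedge_self_odd:
  assumes "a \<in> ext_deg p" "odd p"
  shows "a \<and>\<^sub>e a = 0"
  using wedge_commute[OF assms(1,1)] assms(2) by (simp add: power_int_minus_left vec_eq_iff)

lemma rcontr_wedge:
  assumes a: "a \<in> ext_deg p" and b: "b \<in> ext_deg q"
  shows "rcontr m (a \<and>\<^sub>e b) = a \<and>\<^sub>e rcontr m b + (-1) powi q *\<^sub>R (rcontr m a \<and>\<^sub>e b)"
  unfolding rcontr_lcontr[OF wedge_deg[OF a b]] rcontr_lcontr[OF a] rcontr_lcontr[OF b] lcontr_wedge[OF a]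
  by (auto simp: wedge.scaleR_left wedge.scaleR_right power_int_minus_left scaleR_add_right)

lemma rcontr_anticommute: "rcontr m (rcontr j u) = - rcontr j (rcontr m u)"
proof (rule vec_eq_iff[THEN iffD2], rule allI)
  fix J :: "'a set"
  show "rcontr m (rcontr j u) $ J = (- rcontr j (rcontr m u)) $ J"
  proof (cases "m \<in> J \<or> j \<in> J \<or> m = j")
    case True
    thus ?thesis by (auto simp: rcontr_def)
  next
    case False
    have "ext_sign (insert m J) {j} = ext_sign {m} {j} * ext_sign J {j}"
      "ext_sign (insert j J) {m} = ext_sign {j} {m} * ext_sign J {m}"
      using ext_sign_Un1[of "{m}" J "{j}"] ext_sign_Un1[of "{j}" J "{m}"] False by auto
    moreover have "ext_sign {m} {j} = - ext_sign {j} {m}"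
      using ext_sign_commute[of "{m}" "{j}"] False by auto
    moreover have "m \<noteq> j" "j \<noteq> m" using False by auto
    ultimately show ?thesis using False by (simp add: rcontr_def insert_commute)
  qed
qed

text \<open>
  Removing the factor \<open>m\<close> from a basis element and wedging it back in front reproduces the element,
  as the two signs cancel, so each index of the element contributes once.
\<close>

lemma sum_axis_wedge_lcontr:
  assumes "u \<in> ext_deg l"
  shows "(\<Sum>m\<in>UNIV. axis {m} 1 \<and>\<^sub>e lcontr m u) = real_of_int l *\<^sub>R u"
proof (rule vec_eq_iff[THEN iffD2], rule allI)
  fix K :: "'a set"
  have "(axis {m} 1 \<and>\<^sub>e lcontr m u) $ K = (if m \<in> K then u $ K else 0)" for m
  proof -
    have "(axis {m} 1 \<and>\<^sub>e lcontr m u) $ K =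
        (\<Sum>I\<in>Pow K. if I = {m} then ext_sign {m} (K - {m}) * lcontr m u $ (K - {m}) else 0)"
      unfolding wedge_nth by (rule sum.cong) (auto simp: axis_def)
    also have "\<dots> = (if m \<in> K then u $ K else 0)"
      using ext_sign_square[of "{m}" "K - {m}"]
      by (simp add: lcontr_def insert_absorb flip: mult.assoc)
    finally show ?thesis .
  qed
  hence "(\<Sum>m\<in>UNIV. axis {m} 1 \<and>\<^sub>e lcontr m u) $ K = real (card K) * u $ K"
    by (simp add: sum.If_cases)
  also have "\<dots> = (real_of_int l *\<^sub>R u) $ K"
    using assms by (cases "int (card K) = l") (auto simp: ext_deg_def)
  finally show "(\<Sum>m\<in>UNIV. axis {m} 1 \<and>\<^sub>e lcontr m u) $ K = (real_of_int l *\<^sub>R u) $ K" .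
qed

text \<open>
  Lets an induction on \<open>I\<close> reach every basis element by wedging with one vector at a time, in any
  order; the sign accounts for sorting.
\<close>

lemma axis_insert_wedge:
  assumes "i \<notin> I"
  shows "axis (insert i I) 1 = ext_sign {i} I *\<^sub>R (axis {i} 1 \<and>\<^sub>e axis I 1)"
proof (rule vec_eq_iff[THEN iffD2], rule allI)
  fix K :: "'a set"
  have "(axis {i} 1 \<and>\<^sub>e axis I 1) $ K =
      (\<Sum>J\<in>Pow K. if J = {i} then ext_sign {i} (K - {i}) * axis I 1 $ (K - {i}) else 0)"
    unfolding wedge_nth by (rule sum.cong) (auto simp: axis_def)
  also have "\<dots> = (if K = insert i I then ext_sign {i} I else 0)"
    using assms by (auto simp: axis_def)
  finally show "axis (insert i I) 1 $ K = (ext_sign {i} I *\<^sub>R (axis {i} 1 \<and>\<^sub>e axis I 1)) $ K"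
    by (simp add: axis_def ext_sign_square)
qed

section \<open>Partial derivatives of polynomials\<close>

lemma real_polynomial_function_has_derivative:
  fixes p :: "'a::euclidean_space \<Rightarrow> real"
  assumes "real_polynomial_function p"
  shows "(p has_derivative frechet_derivative p (at x)) (at x)"
  using differentiable_at_real_polynomial_function[OF assms, of x UNIV] frechet_derivative_works by blast

text \<open>
  The two claims are proved in one induction because the product rule for second derivatives
  requires the first derivatives to be differentiable, that is, polynomial.
\<close>

lemma real_polynomial_function_derivatives:
  fixes p :: "'a::euclidean_space \<Rightarrow> real"
  assumes "real_polynomial_function p"
  shows "real_polynomial_function (\<lambda>x. frechet_derivative p (at x) v) \<and>
    frechet_derivative (\<lambda>x. frechet_derivative p (at x) v) (at y) w =
    frechet_derivative (\<lambda>x. frechet_derivative p (at x) w) (at y) v"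
  using assms
proof (induction p arbitrary: v w y)
  case (linear f)
  have "frechet_derivative f (at x) = f" for x
    using bounded_linear_imp_has_derivative[OF linear] frechet_derivative_at by metis
  thus ?case by (simp add: real_polynomial_function.intros)
next
  case (const c)
  show ?case by (simp add: real_polynomial_function.intros)
next
  case (add f g)
  note d = real_polynomial_function_has_derivative
  have 1: "frechet_derivative (\<lambda>x. f x + g x) (at x) u =
      frechet_derivative f (at x) u + frechet_derivative g (at x) u" for x u
    using fun_cong[OF frechet_derivative_at[OF has_derivative_add[OF add.hyps[THEN d]]]] by simp
  have 2: "frechet_derivative (\<lambda>x. frechet_derivative f (at x) u + frechet_derivative g (at x) u) (at y) h =
      frechet_derivative (\<lambda>x. frechet_derivative f (at x) u) (at y) h +
      frechet_derivative (\<lambda>x. frechet_derivative g (at x) u) (at y) h" for u h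
    using fun_cong[OF frechet_derivative_at[OF has_derivative_add[OF
      d[OF add.IH(1)[THEN conjunct1]] d[OF add.IH(2)[THEN conjunct1]]]]] by simp
  show ?case unfolding 1 2
    using add.IH by (auto intro: real_polynomial_function.intros)
next
  case (mult f g)
  note d = real_polynomial_function_has_derivative
  have 1: "frechet_derivative (\<lambda>x. f x * g x) (at x) u =
      f x * frechet_derivative g (at x) u + frechet_derivative f (at x) u * g x" for x u
    using fun_cong[OF frechet_derivative_at[OF has_derivative_mult[OF mult.hyps[THEN d]]]] by simp
  have 2: "frechet_derivative (\<lambda>x. f x * frechet_derivative g (at x) u + frechet_derivative f (at x) u * g x) (at y) h =
      (f y * frechet_derivative (\<lambda>x. frechet_derivative g (at x) u) (at y) h
         + frechet_derivative f (at y) h * frechet_derivative g (at y) u) +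
      (frechet_derivative f (at y) u * frechet_derivative g (at y) h
         + frechet_derivative (\<lambda>x. frechet_derivative f (at x) u) (at y) h * g y)" for u h
    using fun_cong[OF frechet_derivative_at[OF has_derivative_add[OF
      has_derivative_mult[OF d[OF mult.hyps(1)] d[OF mult.IH(2)[THEN conjunct1, of u]]]
      has_derivative_mult[OF d[OF mult.IH(1)[THEN conjunct1, of u]] d[OF mult.hyps(2)]]]], of y h] by simp
  have "frechet_derivative (\<lambda>x. frechet_derivative f (at x) v) (at y) w =
      frechet_derivative (\<lambda>x. frechet_derivative f (at x) w) (at y) v"
    "frechet_derivative (\<lambda>x. frechet_derivative g (at x) v) (at y) w =
      frechet_derivative (\<lambda>x. frechet_derivative g (at x) w) (at y) v"
    using mult.IH by blast+
  thus ?case unfolding 1 2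
    using mult by (auto intro!: real_polynomial_function.intros(3,4))
qed

lemmas real_polynomial_function_derivative = real_polynomial_function_derivatives[THEN conjunct1]
lemmas real_polynomial_function_derivative_commute = real_polynomial_function_derivatives[THEN conjunct2]

lemma pd_nth:
  assumes "polynomial_function U"
  shows "pd m U x $ I = frechet_derivative (\<lambda>x. U x $ I) (at x) (axis m 1)"
  using fun_cong[OF frechet_derivative_at[OF
    bounded_linear.has_derivative[OF bounded_linear_vec_nth pd_has_derivative[OF assms]]]]
  by (simp add: pd_def)

lemma polynomial_function_pd:
  assumes "polynomial_function U"
  shows "polynomial_function (pd m U)"
  unfolding polynomial_function_vec_nth pd_nth[OF assms] real_polynomial_function_eq[symmetric]
  using assms
  by (intro allI real_polynomial_function_derivative)
    (simp add: polynomial_function_vec_nth real_polynomial_function_eq)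

lemma pd_commute:
  assumes "polynomial_function U"
  shows "pd m (pd j U) x = pd j (pd m U) x"
proof (rule vec_eq_iff[THEN iffD2], rule allI)
  fix I
  have "real_polynomial_function (\<lambda>x. U x $ I)"
    using assms by (auto simp: polynomial_function_vec_nth real_polynomial_function_eq)
  thus "pd m (pd j U) x $ I = pd j (pd m U) x $ I"
    unfolding pd_nth[OF polynomial_function_pd[OF assms]] pd_nth[OF assms]
    by (rule real_polynomial_function_derivative_commute)
qed

lemma pd_linear_image:
  assumes "linear f" "polynomial_function U"
  shows "pd m (\<lambda>x. f (U x)) x = f (pd m U x)"
  using pd_eqI[OF bounded_linear.has_derivative[OF linear_conv_bounded_linear[THEN iffD1, OF assms(1)]
    pd_has_derivative[OF assms(2)]]]
  by (simp add: pd_def)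

lemma pd_zero: "pd m (\<lambda>x. 0) x = 0"
  by (rule pd_eqI) (rule has_derivative_const)

lemma pd_sum:
  assumes "finite S" "\<And>i. i \<in> S \<Longrightarrow> polynomial_function (U i)"
  shows "pd m (\<lambda>x. \<Sum>i\<in>S. U i x) x = (\<Sum>i\<in>S. pd m (U i) x)"
  using pd_eqI[OF has_derivative_sum[OF pd_has_derivative[OF assms(2)]]]
  by (simp add: pd_def)

lemma poly_field_polynomial: "U \<in> poly_field u \<Longrightarrow> polynomial_function U"
  by (simp add: poly_field_def)

lemma polynomial_function_wedge:
  assumes "polynomial_function U" "polynomial_function W"
  shows "polynomial_function (\<lambda>x. U x \<and>\<^sub>e W x)"
  using assms
  by (auto simp: polynomial_function_vec_nth wedge_nth simp flip: real_polynomial_function_eq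
      intro!: real_polynomial_function_sum real_polynomial_function.intros(2-4))

lemma poly_field_wedge:
  assumes "U \<in> poly_field u" "W \<in> poly_field w"
  shows "(\<lambda>x. U x \<and>\<^sub>e W x) \<in> poly_field (u + w)"
  using assms by (auto simp: poly_field_iff polynomial_function_wedge wedge_deg)

lemma polynomial_function_trace_op:
  assumes "polynomial_function U"
  shows "polynomial_function (trace_op U)"
proof -
  have "polynomial_function (\<lambda>x. rcontr m (pd m U x))" for m
    unfolding comp_def[symmetric]
    by (intro polynomial_function_compose polynomial_function_pd assms
      polynomial_function_bounded_linear linear_rcontr[THEN linear_conv_bounded_linear[THEN iffD1]])
  hence "polynomial_function (\<lambda>x. \<Sum>m\<in>UNIV. rcontr m (pd m U x))"
    by (intro polynomial_function_sum[OF finite])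
  thus ?thesis by (simp add: trace_op_def[abs_def])
qed

lemma ext_deg_sum: "(\<And>i. i \<in> S \<Longrightarrow> f i \<in> ext_deg l) \<Longrightarrow> (\<Sum>i\<in>S. f i) \<in> ext_deg l"
  by (auto simp: ext_deg_def)

lemma poly_field_trace_op:
  assumes "U \<in> poly_field u"
  shows "trace_op U \<in> poly_field (u - 1)"
  using assms
  by (auto simp: poly_field_iff polynomial_function_trace_op trace_op_def intro!: ext_deg_sum rcontr_deg pd_deg)

lemma trace_op_linear:
  assumes "polynomial_function U" "polynomial_function U'"
  shows "trace_op (\<lambda>x. a *\<^sub>R U x + U' x) x = a *\<^sub>R trace_op U x + trace_op U' x"
  by (simp add: trace_op_def pd_linear[OF assms] linear_add[OF linear_rcontr] linear_scale[OF linear_rcontr]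
      sum.distrib scaleR_sum_right)

lemma trace_op_zero: "trace_op (\<lambda>x. 0) x = 0"
  by (simp add: trace_op_def pd_zero linear_0[OF linear_rcontr])

lemma trace_op_scaleR:
  assumes "polynomial_function U"
  shows "trace_op (\<lambda>x. a *\<^sub>R U x) x = a *\<^sub>R trace_op U x"
  using trace_op_linear[OF assms, of "\<lambda>x. 0" a x] by (simp add: trace_op_zero)

text \<open>Partial derivatives commute, whereas contractions anticommute.\<close>

lemma trace_op_trace_op:
  assumes "polynomial_function U"
  shows "trace_op (trace_op U) x = 0"
proof -
  have pol: "polynomial_function (\<lambda>x. rcontr j (pd j U x))" for j
    using polynomial_function_compose[OF polynomial_function_pd[OF assms]
      polynomial_function_bounded_linear[OF linear_rcontr[THEN linear_conv_bounded_linear[THEN iffD1]]]]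
    by (simp add: o_def)
  have dd: "trace_op (trace_op U) x = (\<Sum>m\<in>UNIV. \<Sum>j\<in>UNIV. rcontr m (rcontr j (pd m (pd j U) x)))"
    unfolding trace_op_def[of "trace_op U"] unfolding trace_op_def[abs_def]
    by (simp add: pd_sum pol pd_linear_image[OF linear_rcontr polynomial_function_pd[OF assms]]
        linear_sum[OF linear_rcontr])
  also have "\<dots> = (\<Sum>j\<in>UNIV. \<Sum>m\<in>UNIV. - rcontr j (rcontr m (pd j (pd m U) x)))"
    by (subst sum.swap, subst rcontr_anticommute, subst pd_commute[OF assms], rule refl)
  also have "\<dots> = - trace_op (trace_op U) x"
    unfolding dd by (simp add: sum_negf)
  finally have "2 *\<^sub>R trace_op (trace_op U) x = 0" by (simp add: scaleR_2)
  thus ?thesis by simp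
qed

section \<open>The Schouten bracket and the trace operator\<close>

text \<open>
  Each of the terms \<open>rcontr m (\<partial>\<^sub>m (U \<and> W))\<close> splits into four, as both the derivative and the contraction
  fall on \<open>U\<close> or on \<open>W\<close>. When they fall on the same factor this is a trace; the two mixed terms
  form the bracket.
\<close>

lemma trace_op_wedge:
  assumes U: "U \<in> poly_field u" and W: "W \<in> poly_field w"
  shows "trace_op (\<lambda>x. U x \<and>\<^sub>e W x) x =
    U x \<and>\<^sub>e trace_op W x + (-1) powi w *\<^sub>R (trace_op U x \<and>\<^sub>e W x + schouten U W x)"
proof -
  let ?s = "(-1) powi w :: real"
  have deg: "U x \<in> ext_deg u" "W x \<in> ext_deg w" using U W by (auto simp: poly_field_iff)
  have sign: "- ?s = (-1) powi (w - 1)" by (auto simp: power_int_minus_left)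
  have "rcontr m (pd m (\<lambda>x. U x \<and>\<^sub>e W x) x) =
      U x \<and>\<^sub>e rcontr m (pd m W x) + ?s *\<^sub>R (rcontr m (pd m U x) \<and>\<^sub>e W x
        + (rcontr m (U x) \<and>\<^sub>e pd m W x - pd m U x \<and>\<^sub>e lcontr m (W x)))" for m
    unfolding pd_wedge[OF U[THEN poly_field_polynomial] W[THEN poly_field_polynomial]]
      linear_add[OF linear_rcontr] rcontr_wedge[OF deg(1) pd_deg[OF W]] rcontr_wedge[OF pd_deg[OF U] deg(2)]
      rcontr_lcontr[OF deg(2)] sign[symmetric]
    by (simp add: wedge.scaleR_right wedge.minus_right scaleR_add_right scaleR_diff_right)
  thus ?thesis
    by (simp add: trace_op_def schouten_def sum.distrib wedge.sum_left wedge.sum_right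
        scaleR_add_right scaleR_sum_right)
qed

text \<open>
  Apply the trace to \<open>trace_op_wedge\<close> and use \<open>trace_op_trace_op\<close>. The two traces of wedge products that remain
  are again given by \<open>trace_op_wedge\<close>, and their terms \<open>trace_op U \<and> trace_op W\<close> cancel.
\<close>

lemma trace_op_schouten:
  assumes U: "U \<in> poly_field u" and W: "W \<in> poly_field w"
  shows "trace_op (schouten U W) x =
    schouten U (trace_op W) x - (-1) powi w *\<^sub>R schouten (trace_op U) W x"
proof -
  let ?s = "(-1) powi w :: real"
  have ss: "?s * ?s = 1" by (auto simp: power_int_minus_left)
  have DU: "trace_op U \<in> poly_field (u - 1)" and DW: "trace_op W \<in> poly_field (w - 1)"
    using U W by (auto intro: poly_field_trace_op)
  have pol: "polynomial_function U" "polynomial_function W" "polynomial_function (trace_op U)"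
    "polynomial_function (trace_op W)"
    using U W DU DW by (auto intro: poly_field_polynomial)
  have sign: "(-1) powi (w - 1) = - ?s" by (auto simp: power_int_minus_left)
  let ?UW = "\<lambda>x. U x \<and>\<^sub>e W x" and ?V = "\<lambda>x. U x \<and>\<^sub>e trace_op W x" and ?Z = "\<lambda>x. trace_op U x \<and>\<^sub>e W x"
  have polw: "polynomial_function (trace_op ?UW)" "polynomial_function ?V" "polynomial_function ?Z"
    by (intro polynomial_function_trace_op polynomial_function_wedge pol)+
  have "schouten U W = (\<lambda>x. ?s *\<^sub>R trace_op ?UW x + ((- ?s) *\<^sub>R ?V x + (-1) *\<^sub>R ?Z x))"
    unfolding trace_op_wedge[OF U W] by (auto simp: scaleR_add_right ss)
  hence "trace_op (schouten U W) x = ?s *\<^sub>R trace_op (trace_op ?UW) x +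
      ((- ?s) *\<^sub>R trace_op ?V x + (-1) *\<^sub>R trace_op ?Z x)"
    by (simp only: trace_op_linear trace_op_scaleR polw polynomial_function_add polynomial_function_cmul)
  thus ?thesis
    unfolding trace_op_trace_op[OF polynomial_function_wedge[OF pol(1,2)]]
      trace_op_wedge[OF U DW] trace_op_wedge[OF DU W] trace_op_trace_op[OF pol(1)] trace_op_trace_op[OF pol(2)] sign
    by (simp add: wedge.zero_left wedge.zero_right scaleR_add_right scaleR_diff_right ss)
qed

section \<open>Uniqueness of the Schouten bracket\<close>

lemma polynomial_function_scaleR_axis:
  "polynomial_function g \<Longrightarrow> polynomial_function (\<lambda>x. g x *\<^sub>R (axis I 1 :: real ^ 'm::finite))"
  by (auto simp: polynomial_function_vec_nth simp flip: real_polynomial_function_eq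
    intro!: real_polynomial_function.intros(2,4))

lemma poly_field_axis:
  assumes "polynomial_function g"
  shows "(\<lambda>x. g x *\<^sub>R axis I 1) \<in> poly_field (int (card I))"
  using polynomial_function_scaleR_axis[OF assms] by (auto simp: poly_field_def axis_def)

context
  fixes B :: "('n::{finite,linorder}) field \<Rightarrow> 'n field \<Rightarrow> 'n field"
  assumes B: "schouten_bracket B"
begin

lemma bracket_linear_right:
  assumes "polynomial_function W" "polynomial_function U" "polynomial_function U'"
  shows "B W (\<lambda>x. a *\<^sub>R U x + U' x) = (\<lambda>x. a *\<^sub>R B W U x + B W U' x)"
  by (rule B[unfolded schouten_bracket_def, THEN conjunct1, rule_format, THEN conjunct2, OF assms(2,3,1)])

lemma bracket_linear_left:
  assumes "polynomial_function W" "polynomial_function U" "polynomial_function U'"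
  shows "B (\<lambda>x. a *\<^sub>R U x + U' x) W = (\<lambda>x. a *\<^sub>R B U W x + B U' W x)"
  by (rule B[unfolded schouten_bracket_def, THEN conjunct1, rule_format, THEN conjunct1, OF assms(2,3,1)])

lemma bracket_vector:
  assumes "X \<in> poly_field 1" "U \<in> poly_field u"
  shows "B X U = lie_deriv X U"
  by (rule B[unfolded schouten_bracket_def, THEN conjunct2, THEN conjunct1, rule_format, OF assms])

lemma bracket_functions:
  assumes "f \<in> poly_field 0" "g \<in> poly_field 0"
  shows "B f g = (\<lambda>x. 0)"
  by (rule B[unfolded schouten_bracket_def, THEN conjunct2, THEN conjunct2, THEN conjunct1, rule_format, OF assms])

lemma bracket_antisym:
  assumes "U \<in> poly_field u" "W \<in> poly_field w"
  shows "B U W = (\<lambda>x. - ((-1) powi ((u - 1) * (w - 1)) *\<^sub>R B W U x))"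
  by (rule B[unfolded schouten_bracket_def, THEN conjunct2, THEN conjunct2, THEN conjunct2, THEN conjunct1, rule_format, OF assms])

lemma bracket_wedge:
  assumes "U \<in> poly_field u" "W \<in> poly_field w" "Z \<in> poly_field z"
  shows "B U (\<lambda>x. W x \<and>\<^sub>e Z x) =
    (\<lambda>x. B U W x \<and>\<^sub>e Z x + (-1) powi ((u - 1) * w) *\<^sub>R (W x \<and>\<^sub>e B U Z x))"
  by (rule B[unfolded schouten_bracket_def, THEN conjunct2, THEN conjunct2, THEN conjunct2, THEN conjunct2, rule_format, OF assms])

lemma bracket_sum_right:
  assumes "polynomial_function U" "finite S" "\<And>i. i \<in> S \<Longrightarrow> polynomial_function (W i)"
  shows "B U (\<lambda>x. \<Sum>i\<in>S. W i x) = (\<lambda>x. \<Sum>i\<in>S. B U (W i) x)"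
  using assms(2,3)
proof (induction S rule: finite_induct)
  case empty
  have "B U (\<lambda>x. 0) = (\<lambda>x. 0)"
  proof
    fix x
    \<comment> \<open>The bracket is only known to respect combinations \<open>a U + U'\<close>, hence the detour to the zero field.\<close>
    have "B U (\<lambda>x. (-1) *\<^sub>R 0 + 0) x = (-1) *\<^sub>R B U (\<lambda>x. 0) x + B U (\<lambda>x. 0) x"
      using bracket_linear_right[OF assms(1), of "\<lambda>x. 0" "\<lambda>x. 0" "-1"] by (rule fun_cong) simp_all
    thus "B U (\<lambda>x. 0) x = 0" by simp
  qed
  thus ?case by simp
next
  case (insert i S)
  have pol: "polynomial_function (W i)" "polynomial_function (\<lambda>x. \<Sum>i\<in>S. W i x)"
    using insert.prems insert.hyps(1) by (auto intro!: polynomial_function_sum)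
  have IH: "B U (\<lambda>x. \<Sum>i\<in>S. W i x) = (\<lambda>x. \<Sum>i\<in>S. B U (W i) x)"
    by (rule insert.IH) (simp add: insert.prems)
  show ?case
    using bracket_linear_right[OF assms(1) pol, of 1] insert.hyps unfolding IH by simp
qed

end

text \<open>
  By antisymmetry the bracket with a vector field is a Lie derivative, so the two brackets with \<open>U\<close> agree on
  vector fields. Functions and vector fields generate all polynomial multivector fields, and the Leibniz rule
  propagates the agreement to products.
\<close>

lemma schouten_bracket_determined_by_functions:
  assumes B: "schouten_bracket B" and B': "schouten_bracket B'"
    and U: "U \<in> poly_field u" and W: "W \<in> poly_field w"
    and agree: "\<And>g. g \<in> poly_field 0 \<Longrightarrow> B U g = B' U g"
  shows "B U W = B' U W"
proof -
  have vec: "B U X = B' U X" if X: "X \<in> poly_field 1" for X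
    unfolding bracket_antisym[OF B U X] bracket_antisym[OF B' U X] bracket_vector[OF B X U] bracket_vector[OF B' X U] ..
  have basis: "B U (\<lambda>x. g x *\<^sub>R axis I 1) = B' U (\<lambda>x. g x *\<^sub>R axis I 1)" if "polynomial_function g" for g I
    using finite[of I] that
  proof (induction I arbitrary: g rule: finite_induct)
    case empty
    thus ?case using poly_field_axis[of g "{}"] by (auto intro: agree)
  next
    case (insert i I)
    let ?X = "\<lambda>x. (g x * ext_sign {i} I) *\<^sub>R (axis {i} 1 :: 'a ext)" and ?Z = "\<lambda>x::(real, 'a) vec. 1 *\<^sub>R (axis I 1 :: 'a ext)"
    have X: "?X \<in> poly_field 1"
      using poly_field_axis[of "\<lambda>x. g x * ext_sign {i} I" "{i}"] insert.prems
        polynomial_function_cmul[of g "ext_sign {i} I"]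
      by (simp add: mult.commute)
    have Z: "?Z \<in> poly_field (int (card I))" by (rule poly_field_axis) simp
    have split: "(\<lambda>x. g x *\<^sub>R axis (insert i I) 1) = (\<lambda>x. ?X x \<and>\<^sub>e ?Z x)"
      by (simp add: axis_insert_wedge[OF insert.hyps(2)] wedge.scaleR_left)
    have "B U ?Z = B' U ?Z" by (rule insert.IH) simp
    thus ?case unfolding split bracket_wedge[OF B U X Z] bracket_wedge[OF B' U X Z] vec[OF X] by simp
  qed
  have comp: "polynomial_function (\<lambda>x. W x $ I)" for I
    using poly_field_polynomial[OF W] by (simp add: polynomial_function_vec_nth)
  have expand: "(\<lambda>x. \<Sum>I\<in>UNIV. W x $ I *\<^sub>R axis I 1) = W"
  proof
    fix x show "(\<Sum>I\<in>UNIV. W x $ I *\<^sub>R axis I 1) = W x"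
      using basis_expansion[of "W x"] by (simp add: scalar_mult_eq_scaleR)
  qed
  have comps: "polynomial_function (\<lambda>x. W x $ I *\<^sub>R (axis I 1 :: 'a ext))" for I
    by (rule polynomial_function_scaleR_axis[OF comp])
  have "B U (\<lambda>x. \<Sum>I\<in>UNIV. W x $ I *\<^sub>R axis I 1) = B' U (\<lambda>x. \<Sum>I\<in>UNIV. W x $ I *\<^sub>R axis I 1)"
    unfolding bracket_sum_right[OF B poly_field_polynomial[OF U] finite comps]
      bracket_sum_right[OF B' poly_field_polynomial[OF U] finite comps] basis[OF comp] ..
  thus ?thesis unfolding expand .
qed

text \<open>
  The criterion \<open>schouten_bracket_determined_by_functions\<close> is used twice: for a function in the first slot it holds
  because brackets of functions vanish, and antisymmetry then verifies it for every \<open>U\<close>.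
\<close>

theorem schouten_bracket_unique:
  assumes B: "schouten_bracket B" and B': "schouten_bracket B'"
    and U: "U \<in> poly_field u" and W: "W \<in> poly_field w"
  shows "B U W = B' U W"
proof (rule schouten_bracket_determined_by_functions[OF B B' U W])
  fix g :: "'a field" assume g: "g \<in> poly_field 0"
  have "B g U = B' g U"
    by (rule schouten_bracket_determined_by_functions[OF B B' g U])
      (simp add: bracket_functions[OF B g] bracket_functions[OF B' g])
  thus "B U g = B' U g"
    by (simp add: bracket_antisym[OF B U g] bracket_antisym[OF B' U g])
qed

section \<open>Homogeneous fields and the Euler field\<close>

text \<open>
  Scaling only by \<open>t > 0\<close> keeps \<open>t\<close> invertible, so that differentiation lowers the degree by one
  without exception, also from \<open>0\<close> to \<open>-1\<close>.
\<close>

definition homogeneous :: "int \<Rightarrow> ('n::finite) field \<Rightarrow> bool" where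
  "homogeneous k U \<longleftrightarrow> (\<forall>t>0. \<forall>x. U (t *\<^sub>R x) = t powi k *\<^sub>R U x)"

lemma hom_poly_scale:
  assumes "hom_poly k f"
  shows "f (t *\<^sub>R x) = t ^ k * f x"
proof -
  obtain c where c: "\<And>x. f x = (\<Sum>\<alpha>\<in>{\<alpha>. (\<Sum>i\<in>UNIV. \<alpha> i) = k}. c \<alpha> * (\<Prod>i\<in>UNIV. (x $ i) ^ \<alpha> i))"
    using assms by (auto simp: hom_poly_def)
  show ?thesis unfolding c sum_distrib_left
    by (rule sum.cong) (auto simp: power_mult_distrib prod.distrib simp flip: power_sum)
qed

lemma hom_field_homogeneous:
  assumes "U \<in> hom_field k l"
  shows "homogeneous k U"
  unfolding homogeneous_def
proof (intro allI impI, rule vec_eq_iff[THEN iffD2], rule allI)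
  fix t :: real and x I assume "t > 0"
  show "U (t *\<^sub>R x) $ I = (t powi k *\<^sub>R U x) $ I"
  proof (cases "0 \<le> k \<and> int (card I) = l")
    case True
    hence "hom_poly (nat k) (\<lambda>x. U x $ I)" using assms by (auto simp: hom_field_def dest!: spec[of _ I])
    from hom_poly_scale[OF this, of t x] show ?thesis using True by (simp add: power_int_def)
  next
    case False
    thus ?thesis using assms by (auto simp: hom_field_def dest!: spec[of _ I])
  qed
qed

lemma homogeneous_trace_op:
  assumes hom: "homogeneous k U" and pol: "polynomial_function U"
  shows "homogeneous (k - 1) (trace_op U)"
proof -
  have "pd m U (t *\<^sub>R x) = t powi (k - 1) *\<^sub>R pd m U x" if t: "t > 0" for m t x
  proof -
    have "((\<lambda>x. U (t *\<^sub>R x)) has_derivative (\<lambda>h. frechet_derivative U (at (t *\<^sub>R x)) (t *\<^sub>R h))) (at x)"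
      by (rule has_derivative_compose[of "\<lambda>x. t *\<^sub>R x" "\<lambda>h. t *\<^sub>R h"])
        (auto intro!: derivative_eq_intros pd_has_derivative[OF pol])
    from pd_eqI[OF this, of m] have "pd m (\<lambda>x. U (t *\<^sub>R x)) x = t *\<^sub>R pd m U (t *\<^sub>R x)"
      by (simp add: pd_def[of m U] linear_scale[OF has_derivative_linear[OF pd_has_derivative[OF pol]]])
    moreover have "pd m (\<lambda>x. t powi k *\<^sub>R U x) x = t powi k *\<^sub>R pd m U x"
      using pd_eqI[OF has_derivative_scaleR_right[OF pd_has_derivative[OF pol]]] by (simp add: pd_def)
    ultimately have "t *\<^sub>R pd m U (t *\<^sub>R x) = t *\<^sub>R (t powi (k - 1) *\<^sub>R pd m U x)"
      using hom t by (simp add: homogeneous_def power_int_diff)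
    thus ?thesis using t by (subst (asm) scaleR_cancel_left) simp
  qed
  thus ?thesis
    by (simp add: homogeneous_def trace_op_def linear_scale[OF linear_rcontr] scaleR_sum_right)
qed

text \<open>
  The left-hand side is the derivative of \<open>U\<close> at \<open>x\<close> in the direction \<open>x\<close>, that is, the derivative
  of \<open>t \<mapsto> U (t x) = t\<^sup>k U x\<close> at \<open>t = 1\<close>.
\<close>

lemma euler_identity:
  assumes hom: "homogeneous k U" and pol: "polynomial_function U"
  shows "(\<Sum>m\<in>UNIV. x $ m *\<^sub>R pd m U x) = real_of_int k *\<^sub>R U x"
proof -
  note lin = has_derivative_linear[OF pd_has_derivative[OF pol, of x]]
  have "(\<Sum>m\<in>UNIV. x $ m *\<^sub>R pd m U x) = frechet_derivative U (at x) (\<Sum>m\<in>UNIV. x $ m *\<^sub>R axis m 1)"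
    by (simp add: pd_def linear_sum[OF lin] linear_scale[OF lin])
  also have "(\<Sum>m\<in>UNIV. x $ m *\<^sub>R axis m 1) = x"
    using basis_expansion[of x] by (simp add: scalar_mult_eq_scaleR)
  finally have E: "(\<Sum>m\<in>UNIV. x $ m *\<^sub>R pd m U x) = frechet_derivative U (at x) x" .
  have "((\<lambda>t. U (t *\<^sub>R x)) has_derivative (\<lambda>s. frechet_derivative U (at x) (s *\<^sub>R x))) (at 1)"
    by (rule has_derivative_compose[of "\<lambda>t. t *\<^sub>R x" "\<lambda>s. s *\<^sub>R x"])
      (auto intro!: derivative_eq_intros simp: pd_has_derivative[OF pol])
  hence 1: "((\<lambda>t. U (t *\<^sub>R x)) has_vector_derivative frechet_derivative U (at x) x) (at 1)"
    by (simp add: has_vector_derivative_def linear_scale[OF lin])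
  have "((\<lambda>t. t powi k) has_field_derivative real_of_int k) (at 1)"
    by (auto intro!: derivative_eq_intros)
  hence "((\<lambda>t. t powi k *\<^sub>R U x) has_vector_derivative real_of_int k *\<^sub>R U x) (at 1)"
    using has_vector_derivative_scaleR[of "\<lambda>t. t powi k" "real_of_int k" 1 UNIV "\<lambda>t. U x" 0] by simp
  hence 2: "((\<lambda>t. U (t *\<^sub>R x)) has_vector_derivative real_of_int k *\<^sub>R U x) (at 1)"
    by (rule has_vector_derivative_transform_within_open[where S = "{0<..}"])
      (use hom in \<open>auto simp: homogeneous_def\<close>)
  show ?thesis using E vector_derivative_unique_at[OF 1 2] by simp
qed

lemma euler_field_nth: "euler_field x $ {m} = x $ m"
  by (simp add: euler_field_def axis_def if_distrib cong: if_cong)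

lemma bounded_linear_scaled_euler: "bounded_linear (\<lambda>x. c *\<^sub>R euler_field x)"
  by (simp add: linear_iff euler_field_def scaleR_add_left sum.distrib scaleR_sum_right distrib_left mult.left_commute
      flip: linear_conv_bounded_linear)

lemma poly_field_scaled_euler: "(\<lambda>x. c *\<^sub>R euler_field x) \<in> poly_field 1"
proof -
  have "c *\<^sub>R euler_field x \<in> ext_deg 1" for x :: "(real, 'a) vec"
    unfolding euler_field_def scaleR_sum_right
    by (rule ext_deg_sum) (auto simp: ext_deg_def axis_def)
  thus ?thesis
    by (simp add: poly_field_iff polynomial_function_bounded_linear bounded_linear_scaled_euler)
qed

lemma pd_scaled_euler: "pd m (\<lambda>x. c *\<^sub>R euler_field x) x = c *\<^sub>R axis {m} 1"
proof -
  have "euler_field (axis m 1) = axis {m} 1"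
    by (simp add: euler_field_def axis_def[of m] if_distrib[of "\<lambda>t. t *\<^sub>R _"] cong: if_cong)
  thus ?thesis
    using pd_eqI[OF bounded_linear_imp_has_derivative[OF bounded_linear_scaled_euler]] by metis
qed

text \<open>
  The transport term of the Lie derivative contributes \<open>k\<close> by the Euler identity, and the contraction term
  contributes \<open>-l\<close>, one for each index.
\<close>

lemma schouten_scaled_euler:
  assumes hom: "homogeneous k U" and U: "U \<in> poly_field l"
  shows "schouten (\<lambda>x. c *\<^sub>R euler_field x) U x = (c * real_of_int (k - l)) *\<^sub>R U x"
proof -
  have deg: "(c *\<^sub>R euler_field x :: 'a ext) \<in> ext_deg 1" "U x \<in> ext_deg l"
    using U poly_field_scaled_euler by (auto simp: poly_field_iff)
  have "schouten (\<lambda>x. c *\<^sub>R euler_field x) U x =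
      c *\<^sub>R (\<Sum>m\<in>UNIV. x $ m *\<^sub>R pd m U x) - c *\<^sub>R (\<Sum>m\<in>UNIV. axis {m} 1 \<and>\<^sub>e lcontr m (U x))"
    by (simp add: schouten_def rcontr_vector[OF deg(1)] pd_scaled_euler euler_field_nth wedge.scaleR_left
        sum_subtractf scaleR_sum_right)
  thus ?thesis
    unfolding euler_identity[OF hom poly_field_polynomial[OF U]] sum_axis_wedge_lcontr[OF deg(2)]
    by (simp add: scaleR_diff_left right_diff_distrib)
qed


section \<open>The bracket of a decomposed field\<close>

lemma schouten_add:
  assumes "polynomial_function U" "polynomial_function U'" "polynomial_function W"
  shows schouten_add_left: "schouten (\<lambda>x. U x + U' x) W x = schouten U W x + schouten U' W x"
    and schouten_add_right: "schouten W (\<lambda>x. U x + U' x) x = schouten W U x + schouten W U' x"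
  using bracket_linear_left[OF schouten_bracket_exists assms(3,1,2), of 1]
    bracket_linear_right[OF schouten_bracket_exists assms(3,1,2), of 1]
  by (simp_all add: fun_eq_iff)

text \<open>For odd \<open>u\<close> the sign \<open>(-1) powi ((u - 1) * (u - 1))\<close> is \<open>1\<close>, so the bracket is skew there.\<close>

lemma schouten_self_odd:
  assumes "U \<in> poly_field u" "odd u"
  shows "schouten U U x = 0"
  using schouten_antisym[OF assms(1,1), of x] assms(2) by (simp add: vec_eq_iff power_int_minus_left)

text \<open>
  By the Leibniz rule every bracket with \<open>G = F \<and> e\<close> splits into a bracket with \<open>F\<close> and a bracket with the
  Euler field, and the latter only multiplies by a number. In the first two claims all that remains is a multiple of
  \<open>[F, F] = 0\<close> or contains \<open>F \<and> F = 0\<close>.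
\<close>

lemma schouten_euler_wedge:
  fixes F :: "('n::{finite,linorder}) field" and c :: real
  assumes F: "F \<in> poly_field f" and odd: "odd f" and hom: "homogeneous q F"
  defines "G \<equiv> \<lambda>x. F x \<and>\<^sub>e c *\<^sub>R euler_field x"
  shows schouten_euler_wedge_factor: "schouten F G x = 0"
    and schouten_euler_wedge_self: "schouten G G x = 0"
    and schouten_euler_wedge_even:
      "W \<in> poly_field (f + 1) \<Longrightarrow> homogeneous k W \<Longrightarrow>
        schouten W G x = schouten W F x \<and>\<^sub>e c *\<^sub>R euler_field x
          + (c * real_of_int (k - (f + 1))) *\<^sub>R (F x \<and>\<^sub>e W x)"
proof -
  let ?X = "\<lambda>x. c *\<^sub>R euler_field x :: 'n ext"
  note X = poly_field_scaled_euler[of c, where 'a = 'n]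
  have G: "G \<in> poly_field (f + 1)" unfolding G_def by (rule poly_field_wedge[OF F X])
  have FF: "F x \<and>\<^sub>e F x = 0"
    using F odd by (intro wedge_self_odd) (auto simp: poly_field_iff)
  have XF: "schouten ?X F x = (c * real_of_int (q - f)) *\<^sub>R F x"
    by (rule schouten_scaled_euler[OF hom F])
  have FX: "schouten F ?X x = - schouten ?X F x"
    using schouten_antisym[OF F X] by simp
  show FG: "schouten F G x = 0"
    unfolding G_def schouten_wedge[OF F F X] schouten_self_odd[OF F odd] FX XF
    by (simp add: wedge.zero_left wedge.minus_right wedge.scaleR_right FF)
  have GF: "schouten G F x = 0"
    unfolding schouten_antisym[OF G F] FG by simp
  have GX: "schouten G ?X x = - (c * real_of_int (q - f)) *\<^sub>R G x"
  proof -
    have "schouten G ?X x = - schouten ?X G x" using schouten_antisym[OF G X] by simp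
    also have "schouten ?X G x = schouten ?X F x \<and>\<^sub>e ?X x"
      unfolding G_def schouten_wedge[OF X F X] schouten_self_odd[OF X odd_one] by (simp add: wedge.zero_right)
    finally show ?thesis by (simp add: XF wedge.scaleR_left G_def)
  qed
  have FGx: "F x \<and>\<^sub>e G x = 0"
    unfolding G_def by (simp add: FF wedge.zero_left flip: wedge_assoc)
  have "schouten G (\<lambda>x. F x \<and>\<^sub>e ?X x) x = 0"
    unfolding schouten_wedge[OF G F X] GF GX by (simp add: wedge.zero_left wedge.minus_right wedge.scaleR_right FGx)
  thus "schouten G G x = 0" by (simp only: G_def)
  assume W: "W \<in> poly_field (f + 1)" and homW: "homogeneous k W"
  have WX: "schouten W ?X x = - (c * real_of_int (k - (f + 1))) *\<^sub>R W x"
    using schouten_antisym[OF W X, of x] schouten_scaled_euler[OF homW W, of c x] by simp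
  have sign: "(-1) powi ((f + 1 - 1) * f) = (-1::real)" using odd by (simp add: power_int_minus_left)
  show "schouten W G x = schouten W F x \<and>\<^sub>e ?X x + (c * real_of_int (k - (f + 1))) *\<^sub>R (F x \<and>\<^sub>e W x)"
    unfolding G_def schouten_wedge[OF W F X] WX sign by (simp add: wedge.minus_right wedge.scaleR_right)
qed

lemma schouten_zero_right: "schouten U (\<lambda>x. 0) x = 0"
  by (simp add: schouten_def pd_zero linear_0[OF linear_lcontr] wedge.zero_right)

lemma schouten_zero_left: "schouten (\<lambda>x. 0) U x = 0"
  by (simp add: schouten_def pd_zero linear_0[OF linear_rcontr] wedge.zero_left)

theorem theorem3p8:
  fixes A A0 :: "('n::{finite,linorder}) field"
    and B :: "'n field \<Rightarrow> 'n field \<Rightarrow> 'n field"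
    and k l :: int
  assumes "schouten_bracket B"
    and "A \<in> hom_field k l"
    and "even l"
    and "int CARD('n) + k - l \<noteq> 0"
    and "A0 \<in> hom_field k l"
    and "A = (\<lambda>x. A0 x + trace_op A x \<and>\<^sub>e e_field k l x)"
    and "trace_op A0 = (\<lambda>x. 0)"
  shows "(k \<noteq> l \<longrightarrow>
            (B A A = (\<lambda>x. 0) \<longleftrightarrow>
             B A0 A0 = (\<lambda>x. (2 * real_of_int (l - k) / real_of_int (int CARD('n) + k - l)) *\<^sub>R
                              (trace_op A x \<and>\<^sub>e A0 x))))
       \<and> (k = l \<longrightarrow>
            (B A A = (\<lambda>x. 0) \<longleftrightarrow>
             B A0 A0 = (\<lambda>x. 0) \<and> B (trace_op A) A0 = (\<lambda>x. 0)))"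
proof -
  define F where "F = trace_op A"
  define c where "c = 1 / real_of_int (int CARD('n) + k - l)"
  define G where "G = (\<lambda>x. F x \<and>\<^sub>e c *\<^sub>R euler_field x)"
  have A: "A \<in> poly_field l" and A0: "A0 \<in> poly_field l"
    using assms(2,5) hom_field_subset_poly_field by blast+
  have F: "F \<in> poly_field (l - 1)" unfolding F_def by (rule poly_field_trace_op[OF A])
  have G: "G \<in> poly_field l"
    using poly_field_wedge[OF F poly_field_scaled_euler[of c]] by (simp add: G_def)
  note pol = A[THEN poly_field_polynomial] A0[THEN poly_field_polynomial]
    F[THEN poly_field_polynomial] G[THEN poly_field_polynomial]
  have homA0: "homogeneous k A0" by (rule hom_field_homogeneous[OF assms(5)])
  have homF: "homogeneous (k - 1) F"
    unfolding F_def by (rule homogeneous_trace_op[OF hom_field_homogeneous[OF assms(2)] pol(1)])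
  have odd: "odd (l - 1)" using assms(3) by simp
  have AG: "A = (\<lambda>x. A0 x + G x)"
    using assms(6) by (simp add: G_def F_def e_field_def[abs_def] c_def)

  have FA: "schouten F A x = schouten F A0 x" for x
    by (simp add: AG schouten_add_right[OF pol(2,4,3)] schouten_euler_wedge_factor[OF F odd homF, where c = c, folded G_def])
  have A0F: "schouten A0 F x = - schouten F A0 x" for x
    using schouten_antisym[OF A0 F, of x] assms(3) by (simp add: power_int_minus_left)
  have AA: "schouten A A x = schouten A0 A0 x - 2 *\<^sub>R (schouten F A0 x \<and>\<^sub>e c *\<^sub>R euler_field x)
      - (2 * real_of_int (l - k) * c) *\<^sub>R (F x \<and>\<^sub>e A0 x)" for x
  proof -
    have "schouten A A x = schouten A0 A0 x + schouten A0 G x + (schouten G A0 x + schouten G G x)"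
      using pol by (simp add: AG schouten_add_left schouten_add_right polynomial_function_add)
    also have "schouten G A0 x = schouten A0 G x"
      using schouten_antisym[OF G A0, of x] assms(3) by (simp add: power_int_minus_left)
    also have "schouten G G x = 0" using schouten_euler_wedge_self[OF F odd homF, where c = c] by (simp only: G_def)
    also have "schouten A0 G x = schouten A0 F x \<and>\<^sub>e c *\<^sub>R euler_field x
          + (c * real_of_int (k - l)) *\<^sub>R (F x \<and>\<^sub>e A0 x)"
      using schouten_euler_wedge_even[OF F odd homF, of A0 k c x, folded G_def] A0 homA0 by simp
    finally show ?thesis
      by (simp add: A0F wedge.minus_left vec_eq_iff algebra_simps)
  qed

  have DA0: "trace_op A0 x = 0" for x using assms(7) by simp
  have DAA: "trace_op (schouten A A) x = - 2 *\<^sub>R schouten F A0 x" for x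
  proof -
    have "schouten A F x = - schouten F A x"
      using schouten_antisym[OF A F, of x] assms(3) by (simp add: power_int_minus_left)
    thus ?thesis
      using trace_op_schouten[OF A A, of x] assms(3)
      by (simp add: power_int_minus_left FA vec_eq_iff flip: F_def)
  qed
  have DA0A0: "trace_op (schouten A0 A0) x = 0" for x
    using trace_op_schouten[OF A0 A0, of x]
    by (simp add: assms(7) schouten_zero_left schouten_zero_right)
  have DFA0: "trace_op (\<lambda>x. F x \<and>\<^sub>e A0 x) x = schouten F A0 x" for x
    using trace_op_wedge[OF F A0, of x] assms(3) trace_op_trace_op[OF pol(1), of x]
    by (simp add: F_def[symmetric] DA0 wedge.zero_left wedge.zero_right power_int_minus_left)

  \<comment> \<open>For \<open>k \<noteq> l\<close>, either side of the equivalence makes \<open>[F, A\<^sub>0]\<close> vanish: take the trace of both sides.\<close>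
  have FA0_if: "schouten F A0 x = 0" if "schouten A A = (\<lambda>x. 0)" for x
    using DAA[of x] by (simp add: that trace_op_zero)
  have FA0_if': "schouten F A0 x = 0"
    if "schouten A0 A0 = (\<lambda>x. (2 * real_of_int (l - k) * c) *\<^sub>R (F x \<and>\<^sub>e A0 x))" "k \<noteq> l" for x
  proof -
    have "(2 * real_of_int (l - k) * c) *\<^sub>R schouten F A0 x = 0"
      using DA0A0[of x] unfolding that(1)
      by (simp add: trace_op_scaleR polynomial_function_wedge pol DFA0)
    moreover have "2 * real_of_int (l - k) * c \<noteq> 0"
      using assms(4) that(2) unfolding c_def by (simp flip: of_int_diff of_int_add)
    ultimately show ?thesis by (metis scaleR_eq_0_iff)
  qed
  have BS: "B A A = schouten A A" "B A0 A0 = schouten A0 A0" "B F A0 = schouten F A0"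
    using schouten_bracket_unique[OF assms(1) schouten_bracket_exists] A A0 F by blast+
  have const: "2 * real_of_int (l - k) / real_of_int (int CARD('n) + k - l) = 2 * real_of_int (l - k) * c"
    by (simp add: c_def)
  show ?thesis
    unfolding F_def[symmetric] BS const
  proof (intro conjI impI iffI)
    assume "k \<noteq> l" "schouten A A = (\<lambda>x. 0)"
    thus "schouten A0 A0 = (\<lambda>x. (2 * real_of_int (l - k) * c) *\<^sub>R (F x \<and>\<^sub>e A0 x))"
      using AA FA0_if by (simp add: fun_eq_iff wedge.zero_left)
  next
    assume "k \<noteq> l" "schouten A0 A0 = (\<lambda>x. (2 * real_of_int (l - k) * c) *\<^sub>R (F x \<and>\<^sub>e A0 x))"
    thus "schouten A A = (\<lambda>x. 0)"
      using AA FA0_if' by (simp add: fun_eq_iff wedge.zero_left)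
  next
    assume "k = l" "schouten A A = (\<lambda>x. 0)"
    thus "schouten A0 A0 = (\<lambda>x. 0)"
      using AA FA0_if by (simp add: fun_eq_iff wedge.zero_left)
  next
    assume "schouten A A = (\<lambda>x. 0)"
    thus "schouten F A0 = (\<lambda>x. 0)" using FA0_if by (simp add: fun_eq_iff)
  next
    assume "k = l" "schouten A0 A0 = (\<lambda>x. 0) \<and> schouten F A0 = (\<lambda>x. 0)"
    thus "schouten A A = (\<lambda>x. 0)"
      using AA by (simp add: fun_eq_iff wedge.zero_left)
  qed
qed

end
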